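(* Let $I$ be a database instance, $F$ a finite set of denial constraints, and $\succ$ a priority of $I$ w.r.t. $F$ (in particular $\succ$ is acyclic). For two repairs $I_1',I_2'$ of $I$ w.r.t. $F$, say that $I_1'$ globally dominates $I_2'$, written $I_1'\gg_{\mathcal G} I_2'$, if $$\forall x\in I_2'\setminus I_1'.\ \exists y\in I_1'\setminus I_2'.\ y\succ x.$$ Then: (i) a repair $I'$ of $I$ w.r.t. $F$ is globally optimal w.r.t. $\succ$ and $F$ if and only if there is no repair $I''\neq I'$ of $I$ w.r.t. $F$ such that $I''\gg_{\mathcal G} I'$; (ii) $\gg_{\mathcal G}$ is acyclic, i.e. there is no sequence of $n\ge 2$ pairwise different repairs $I_0',\dots,I_{n-1}'$ with $I_i'\gg_{\mathcal G} I_{i+1}'$ for all $i\in\{0,\dots,n-1\}$ (indices modulo $n$).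
   Context: A database schema is a set of relation names of fixed positive arity; each attribute ranges over one of two disjoint infinite domains: the rationals $\mathbb{Q}$ (with built-in predicates $=,\neq,<,\le,>,\ge$) or a set $D$ of uninterpreted constants (with built-in predicates $=,\neq$). A fact is an expression $R(t)$ with $R$ a relation name and $t$ a tuple of constants of the right arity and types. A database instance is a finite set of facts. A denial constraint is a sentence $\forall\bar x.\ \neg[R_1(\bar x_1)\wedge\dots\wedge R_n(\bar x_n)\wedge\varphi(\bar x)]$ with $n>0$, $\bar x_1\cup\dots\cup\bar x_n=\bar x$, and $\varphi$ a quantifier-free formula using only built-in predicates. A set of facts $\{R_1(t_1),\dots,R_n(t_n)\}\subseteq I$ is a conflict in $I$ w.r.t. $F$ if for some denial constraint $\forall\bar x.\ \neg[R_1(\bar x_1)\wedge\dots\wedge R_n(\bar x_n)\wedge\varphi(\bar x)]$ in $F$ there is a substitution $\rho$ of constants for $\bar x$ such that $\varphi(\rho(\bar x))$ is true and $\rho(\bar x_i)=t_i$ for all $i$; an instance is consistent with $F$ iff it satisfies $F$, i.e. iff it contains no conflict. A repair of $I$ w.r.t. $F$ is a maximal (under inclusion) subset of $I$ consistent with $F$. Two facts of $I$ are neighbors if some conflict contains both. A priority of $I$ w.r.t. $F$ is an acyclic binary relation $\succ$ on $I$ such that $x\succ y$ implies that $x$ and $y$ are neighbors. A set $I'\subseteq I$ is globally optimal w.r.t. $\succ$ and $F$ if there are no nonempty $X\subseteq I'$ and $Y\subseteq I\setminus I'$ such that $\forall x\in X.\ \exists y\in Y.\ y\succ x$ and $(I'\setminus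 X)\cup Y$ is consistent with $F$. *)

theory Defs
  imports Complex_Main "HOL-Library.Infinite_Typeclass"
begin

datatype sort = QSort | DSort

text \<open>The elements of the type variable \<open>'d\<close> are the uninterpreted constants \<open>D\<close>; the
  constructors below keep the two domains disjoint.\<close>

datatype 'd dbconst = Rational rat | Uninterpreted 'd

fun constant_sort :: "'d dbconst \<Rightarrow> sort" where
  "constant_sort (Rational q) = QSort"
| "constant_sort (Uninterpreted d) = DSort"

text \<open>A schema maps each of its relation names to the list of the sorts of its attributes; the
  arity is the length of that list.\<close>

type_synonym 'r schema = "'r \<rightharpoonup> sort list"

definition wf_schema :: "'r schema \<Rightarrow> bool" where
  "wf_schema S \<longleftrightarrow> (\<forall>ss \<in> ran S. ss \<noteq> [])"

datatype ('r, 'd) fact = Fact 'r "'d dbconst list"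

fun wf_fact :: "'r schema \<Rightarrow> ('r, 'd) fact \<Rightarrow> bool" where
  "wf_fact S (Fact R t) \<longleftrightarrow> S R = Some (map constant_sort t)"

definition db_instance :: "'r schema \<Rightarrow> ('r, 'd) fact set \<Rightarrow> bool" where
  "db_instance S I \<longleftrightarrow> finite I \<and> (\<forall>f \<in> I. wf_fact S f)"

datatype var = Var (var_sort: sort) nat

datatype 'd trm = TVar var | TConst "'d dbconst"

datatype builtin = EQ | NEQ | LT | LE | GT | GE

datatype 'd formula =
    Atom builtin "'d trm" "'d trm"
  | Neg "'d formula"
  | Conj "'d formula" "'d formula"
  | Disj "'d formula" "'d formula"

fun trm_sort :: "'d trm \<Rightarrow> sort" where
  "trm_sort (TVar x) = var_sort x"
| "trm_sort (TConst c) = constant_sort c"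

fun trm_vars :: "'d trm \<Rightarrow> var set" where
  "trm_vars (TVar x) = {x}"
| "trm_vars (TConst c) = {}"

fun formula_vars :: "'d formula \<Rightarrow> var set" where
  "formula_vars (Atom p s t) = trm_vars s \<union> trm_vars t"
| "formula_vars (Neg \<phi>) = formula_vars \<phi>"
| "formula_vars (Conj \<phi> \<psi>) = formula_vars \<phi> \<union> formula_vars \<psi>"
| "formula_vars (Disj \<phi> \<psi>) = formula_vars \<phi> \<union> formula_vars \<psi>"

fun wf_formula :: "'d formula \<Rightarrow> bool" where
  "wf_formula (Atom p s t) \<longleftrightarrow>
     trm_sort s = trm_sort t \<and> (p \<in> {LT, LE, GT, GE} \<longrightarrow> trm_sort s = QSort)"
| "wf_formula (Neg \<phi>) \<longleftrightarrow> wf_formula \<phi>"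
| "wf_formula (Conj \<phi> \<psi>) \<longleftrightarrow> wf_formula \<phi> \<and> wf_formula \<psi>"
| "wf_formula (Disj \<phi> \<psi>) \<longleftrightarrow> wf_formula \<phi> \<and> wf_formula \<psi>"

text \<open>\<open>Denial [(R\<^sub>1, x\<^sub>1), \<dots>, (R\<^sub>n, x\<^sub>n)] \<phi>\<close> is the sentence
  \<open>\<forall>x. \<not> (R\<^sub>1(x\<^sub>1) \<and> \<dots> \<and> R\<^sub>n(x\<^sub>n) \<and> \<phi>(x))\<close>.\<close>

datatype ('r, 'd) denial =
  Denial (rel_atoms: "('r \<times> var list) list") (side_cond: "'d formula")

definition wf_denial :: "'r schema \<Rightarrow> ('r, 'd) denial \<Rightarrow> bool" where
  "wf_denial S c \<longleftrightarrow>
     rel_atoms c \<noteq> [] \<and>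
     (\<forall>(R, xs) \<in> set (rel_atoms c). S R = Some (map var_sort xs)) \<and>
     wf_formula (side_cond c) \<and>
     formula_vars (side_cond c) \<subseteq> (\<Union>(R, xs) \<in> set (rel_atoms c). set xs)"

definition substitution :: "(var \<Rightarrow> 'd dbconst) \<Rightarrow> bool" where
  "substitution \<rho> \<longleftrightarrow> (\<forall>x. constant_sort (\<rho> x) = var_sort x)"

fun eval_trm :: "(var \<Rightarrow> 'd dbconst) \<Rightarrow> 'd trm \<Rightarrow> 'd dbconst" where
  "eval_trm \<rho> (TVar x) = \<rho> x"
| "eval_trm \<rho> (TConst c) = c"

text \<open>Order comparisons involving uninterpreted constants are excluded by \<open>wf_formula\<close>; the
  value \<open>False\<close> given to them below is a dummy.\<close>

fun rat_cmp :: "(rat \<Rightarrow> rat \<Rightarrow> bool) \<Rightarrow> 'd dbconst \<Rightarrow> 'd dbconst \<Rightarrow> bool" where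
  "rat_cmp r (Rational p) (Rational q) \<longleftrightarrow> r p q"
| "rat_cmp r _ _ \<longleftrightarrow> False"

fun eval_builtin :: "builtin \<Rightarrow> 'd dbconst \<Rightarrow> 'd dbconst \<Rightarrow> bool" where
  "eval_builtin EQ a b \<longleftrightarrow> a = b"
| "eval_builtin NEQ a b \<longleftrightarrow> a \<noteq> b"
| "eval_builtin LT a b \<longleftrightarrow> rat_cmp (<) a b"
| "eval_builtin LE a b \<longleftrightarrow> rat_cmp (\<le>) a b"
| "eval_builtin GT a b \<longleftrightarrow> rat_cmp (>) a b"
| "eval_builtin GE a b \<longleftrightarrow> rat_cmp (\<ge>) a b"

fun eval_formula :: "(var \<Rightarrow> 'd dbconst) \<Rightarrow> 'd formula \<Rightarrow> bool" where
  "eval_formula \<rho> (Atom p s t) \<longleftrightarrow> eval_builtin p (eval_trm \<rho> s) (eval_trm \<rho> t)"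
| "eval_formula \<rho> (Neg \<phi>) \<longleftrightarrow> \<not> eval_formula \<rho> \<phi>"
| "eval_formula \<rho> (Conj \<phi> \<psi>) \<longleftrightarrow> eval_formula \<rho> \<phi> \<and> eval_formula \<rho> \<psi>"
| "eval_formula \<rho> (Disj \<phi> \<psi>) \<longleftrightarrow> eval_formula \<rho> \<phi> \<or> eval_formula \<rho> \<psi>"

definition ground_facts :: "(var \<Rightarrow> 'd dbconst) \<Rightarrow> ('r, 'd) denial \<Rightarrow> ('r, 'd) fact set" where
  "ground_facts \<rho> c = (\<lambda>(R, xs). Fact R (map \<rho> xs)) ` set (rel_atoms c)"

definition satisfies :: "('r, 'd) fact set \<Rightarrow> ('r, 'd) denial \<Rightarrow> bool" where
  "satisfies I c \<longleftrightarrow>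
     (\<forall>\<rho>. substitution \<rho> \<longrightarrow> \<not> (ground_facts \<rho> c \<subseteq> I \<and> eval_formula \<rho> (side_cond c)))"

definition consistent :: "('r, 'd) denial set \<Rightarrow> ('r, 'd) fact set \<Rightarrow> bool" where
  "consistent F I \<longleftrightarrow> (\<forall>c \<in> F. satisfies I c)"

definition conflict ::
  "('r, 'd) fact set \<Rightarrow> ('r, 'd) denial set \<Rightarrow> ('r, 'd) fact set \<Rightarrow> bool" where
  "conflict I F K \<longleftrightarrow>
     K \<subseteq> I \<and>
     (\<exists>c \<in> F. \<exists>\<rho>. substitution \<rho> \<and> eval_formula \<rho> (side_cond c) \<and> K = ground_facts \<rho> c)"

lemma consistent_iff_no_conflict: "consistent F I \<longleftrightarrow> (\<nexists>K. conflict I F K)"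
  unfolding consistent_def satisfies_def conflict_def by blast

definition repair ::
  "('r, 'd) fact set \<Rightarrow> ('r, 'd) denial set \<Rightarrow> ('r, 'd) fact set \<Rightarrow> bool" where
  "repair I F I' \<longleftrightarrow>
     I' \<subseteq> I \<and> consistent F I' \<and> (\<forall>J. I' \<subset> J \<and> J \<subseteq> I \<longrightarrow> \<not> consistent F J)"

definition neighbors ::
  "('r, 'd) fact set \<Rightarrow> ('r, 'd) denial set \<Rightarrow> ('r, 'd) fact \<Rightarrow> ('r, 'd) fact \<Rightarrow> bool" where
  "neighbors I F x y \<longleftrightarrow> (\<exists>K. conflict I F K \<and> x \<in> K \<and> y \<in> K)"

text \<open>A pair \<open>(x, y)\<close> in a priority means that \<open>x\<close> is preferred to \<open>y\<close>, i.e. \<open>x \<succ> y\<close>.\<close>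

definition priority ::
  "('r, 'd) fact set \<Rightarrow> ('r, 'd) denial set \<Rightarrow> ('r, 'd) fact rel \<Rightarrow> bool" where
  "priority I F P \<longleftrightarrow> P \<subseteq> I \<times> I \<and> acyclic P \<and> (\<forall>(x, y) \<in> P. neighbors I F x y)"

definition globally_optimal ::
  "('r, 'd) fact set \<Rightarrow> ('r, 'd) denial set \<Rightarrow> ('r, 'd) fact rel \<Rightarrow> ('r, 'd) fact set \<Rightarrow> bool" where
  "globally_optimal I F P I' \<longleftrightarrow>
     I' \<subseteq> I \<and>
     \<not> (\<exists>X Y. X \<noteq> {} \<and> X \<subseteq> I' \<and> Y \<noteq> {} \<and> Y \<subseteq> I - I' \<and>
          (\<forall>x \<in> X. \<exists>y \<in> Y. (y, x) \<in> P) \<and> consistent F ((I' - X) \<union> Y))"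

definition globally_dominates ::
  "('r, 'd) fact rel \<Rightarrow> ('r, 'd) fact set \<Rightarrow> ('r, 'd) fact set \<Rightarrow> bool" where
  "globally_dominates P I1 I2 \<longleftrightarrow> (\<forall>x \<in> I2 - I1. \<exists>y \<in> I1 - I2. (y, x) \<in> P)"

end

theory Submission
  imports Defs
begin

text \<open>Extending a consistent set to a repair can only shrink the set of facts lost, so a witness
  \<open>(X, Y)\<close> against global optimality yields a dominating repair; conversely, for a dominating repair
  \<open>I''\<close> the witness is \<open>X = I' - I''\<close> and \<open>Y = I'' - I'\<close>. For acyclicity, consider a cycle of
  repairs and, among the facts entering at some step of the cycle, a \<open>\<succ>\<close>-maximal one \<open>x\<close>. Domination
  provides some \<open>y \<succ> x\<close> leaving at the same step, and going round the cycle \<open>y\<close> must enter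
  again at another step, contradicting the choice of \<open>x\<close>.\<close>

lemma repair_subset_eq:
  assumes "repair I F A" and "repair I F B" and "A \<subseteq> B"
  shows "A = B"
  using assms unfolding repair_def by blast

text \<open>As \<open>I\<close> is finite, it has only finitely many consistent subsets, so one that
  is maximal above \<open>A\<close> exists.\<close>

lemma consistent_extends_to_repair:
  assumes "finite I" and "A \<subseteq> I" and "consistent F A"
  obtains B where "repair I F B" and "A \<subseteq> B"
proof -
  let ?C = "{J. J \<subseteq> I \<and> consistent F J}"
  have "finite ?C"
    using \<open>finite I\<close> by simp
  moreover have "A \<in> ?C"
    using assms by simp
  ultimately obtain B where "B \<in> ?C" and "A \<subseteq> B" and "\<forall>J \<in> ?C. B \<subseteq> J \<longrightarrow> B = J"
    by (elim finite_has_maximal2[THEN bexE]) blast+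
  then have "repair I F B"
    unfolding repair_def by blast
  then show thesis
    using \<open>A \<subseteq> B\<close> by (rule that)
qed

lemma globally_optimal_iff_undominated:
  assumes "finite I" and "repair I F A"
  shows "globally_optimal I F P A \<longleftrightarrow>
           \<not> (\<exists>B. repair I F B \<and> B \<noteq> A \<and> globally_dominates P B A)"
proof
  assume opt: "globally_optimal I F P A"
  show "\<not> (\<exists>B. repair I F B \<and> B \<noteq> A \<and> globally_dominates P B A)"
  proof
    assume "\<exists>B. repair I F B \<and> B \<noteq> A \<and> globally_dominates P B A"
    then obtain B where B: "repair I F B" "B \<noteq> A" "globally_dominates P B A"
      by blast
    \<comment> \<open>Distinct repairs are incomparable under inclusion, by maximality.\<close>
    have "A - B \<noteq> {}" and "B - A \<noteq> {}"
      using repair_subset_eq assms(2) B(1,2) by blast+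
    moreover have "(A - (A - B)) \<union> (B - A) = B"
      by blast
    then have "consistent F ((A - (A - B)) \<union> (B - A))"
      using B(1) by (simp add: repair_def)
    moreover have "B - A \<subseteq> I - A"
      using B(1) by (auto simp: repair_def)
    moreover have "\<forall>x \<in> A - B. \<exists>y \<in> B - A. (y, x) \<in> P"
      using B(3) by (simp add: globally_dominates_def)
    moreover have "A - B \<subseteq> A"
      by blast
    ultimately show False
      using opt unfolding globally_optimal_def by meson
  qed
next
  assume undom: "\<not> (\<exists>B. repair I F B \<and> B \<noteq> A \<and> globally_dominates P B A)"
  have "A \<subseteq> I"
    using assms(2) by (simp add: repair_def)
  show "globally_optimal I F P A"
  proof (rule ccontr)
    assume "\<not> globally_optimal I F P A"
    with \<open>A \<subseteq> I\<close> obtain X Y where XY: "X \<subseteq> A" "Y \<noteq> {}" "Y \<subseteq> I - A"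
        "\<forall>x \<in> X. \<exists>y \<in> Y. (y, x) \<in> P" "consistent F ((A - X) \<union> Y)"
      unfolding globally_optimal_def by blast
    have "(A - X) \<union> Y \<subseteq> I"
      using \<open>A \<subseteq> I\<close> XY(3) by blast
    then obtain B where B: "repair I F B" "(A - X) \<union> Y \<subseteq> B"
      using consistent_extends_to_repair[OF assms(1) _ XY(5)] by blast
    \<comment> \<open>Since \<open>B\<close> contains \<open>A - X\<close>, every fact of
      \<open>A - B\<close> lies in \<open>X\<close>; its dominator in \<open>Y\<close> lies in
      \<open>B - A\<close>.\<close>
    have "globally_dominates P B A"
      unfolding globally_dominates_def using B(2) XY(3,4) by blast
    moreover have "B \<noteq> A"
      using B(2) XY(2,3) by blast
    ultimately show False
      using undom B(1) by blast
  qed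
qed

text \<open>Without an ascent, failure of \<open>Q\<close> at the successor of \<open>i\<close>
  would propagate step by step round the whole cycle and reach \<open>i\<close> itself.\<close>

lemma cyclic_descent_imp_ascent:
  fixes n i :: nat
  assumes "i < n" and "Q i" and "\<not> Q (Suc i mod n)"
  shows "\<exists>j<n. \<not> Q j \<and> Q (Suc j mod n)"
proof (rule ccontr)
  assume no_ascent: "\<not> (\<exists>j<n. \<not> Q j \<and> Q (Suc j mod n))"
  have "\<not> Q ((Suc i + k) mod n)" for k
  proof (induction k)
    case 0
    show ?case
      using assms(3) by simp
  next
    case (Suc k)
    moreover have "Suc ((Suc i + k) mod n) mod n = (Suc i + Suc k) mod n"
      by (simp add: mod_Suc_eq)
    moreover have "(Suc i + k) mod n < n"
      using assms(1) by simp
    ultimately show ?case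
      using no_ascent by metis
  qed
  \<comment> \<open>The index is \<open>i + n\<close> modulo \<open>n\<close>, which is
    \<open>i\<close> because \<open>i < n\<close>.\<close>
  then have "\<not> Q ((Suc i + (n - 1)) mod n)" .
  then show False
    using assms(1,2) by simp
qed

lemma no_globally_dominates_cycle:
  fixes J :: "nat \<Rightarrow> ('r, 'd) fact set"
  assumes "wf P" and "n \<ge> 2" and "\<forall>i<n. repair I F (J i)" and "J 0 \<noteq> J 1"
    and dom: "\<forall>i<n. globally_dominates P (J i) (J (Suc i mod n))"
  shows False
proof -
  define U where "U = (\<Union>i<n. J (Suc i mod n) - J i)"
  have "J 1 - J 0 \<noteq> {}"
    using repair_subset_eq[of I F "J 1" "J 0"] assms(2-4) by auto
  \<comment> \<open>This is the step at index 0: \<open>Suc 0 mod n\<close> is 1 because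
    \<open>n \<ge> 2\<close>.\<close>
  moreover have "J 1 - J 0 \<subseteq> U"
    unfolding U_def using assms(2) by (intro subsetI UN_I[of 0]) auto
  ultimately obtain u where "u \<in> U"
    by blast
  \<comment> \<open>A pair of \<open>P\<close> has the preferred fact first, so minimal for
    \<open>wf P\<close> means most preferred.\<close>
  then obtain x where "x \<in> U" and max: "\<And>y. (y, x) \<in> P \<Longrightarrow> y \<notin> U"
    by (rule wfE_min[OF \<open>wf P\<close>]) blast
  then obtain i where "i < n" and "x \<in> J (Suc i mod n) - J i"
    unfolding U_def by blast
  then obtain y where y: "y \<in> J i" "y \<notin> J (Suc i mod n)" "(y, x) \<in> P"
    using dom unfolding globally_dominates_def by blast
  then have "y \<in> U"
    using cyclic_descent_imp_ascent[of i n "\<lambda>k. y \<in> J k"] \<open>i < n\<close> unfolding U_def by blast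
  with max y(3) show False
    by blast
qed

theorem proposition3:
  fixes S :: "'r schema"
    and I :: "('r, 'd::infinite) fact set"
    and F :: "('r, 'd) denial set"
    and P :: "('r, 'd) fact rel"
  assumes "wf_schema S"
    and "db_instance S I"
    and "finite F"
    and "\<forall>c \<in> F. wf_denial S c"
    and "priority I F P"
  shows "(\<forall>I'. repair I F I' \<longrightarrow>
            (globally_optimal I F P I' \<longleftrightarrow>
             \<not> (\<exists>I''. repair I F I'' \<and> I'' \<noteq> I' \<and> globally_dominates P I'' I'))) \<and>
         \<not> (\<exists>(n::nat) J. n \<ge> 2 \<and> (\<forall>i<n. repair I F (J i)) \<and> inj_on J {..<n} \<and>
              (\<forall>i<n. globally_dominates P (J i) (J (Suc i mod n))))"
proof -
  have "finite I"
    using assms(2) by (simp add: db_instance_def)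
  have "P \<subseteq> I \<times> I" and "acyclic P"
    using assms(5) by (auto simp: priority_def)
  \<comment> \<open>Finiteness turns acyclicity of the priority into well-foundedness, which
    supplies the most preferred facts.\<close>
  have "finite P"
    using \<open>P \<subseteq> I \<times> I\<close> \<open>finite I\<close> by (meson finite_SigmaI finite_subset)
  then have "wf P"
    using \<open>acyclic P\<close> by (rule finite_acyclic_wf)
  have "\<not> (\<exists>(n::nat) J. n \<ge> 2 \<and> (\<forall>i<n. repair I F (J i)) \<and> inj_on J {..<n} \<and>
              (\<forall>i<n. globally_dominates P (J i) (J (Suc i mod n))))"
  proof clarify
    fix n :: nat and J
    assume "n \<ge> 2" and "\<forall>i<n. repair I F (J i)" and "inj_on J {..<n}"
      and "\<forall>i<n. globally_dominates P (J i) (J (Suc i mod n))"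
    moreover have "J 0 \<noteq> J 1"
      using inj_onD[OF \<open>inj_on J {..<n}\<close>, of 0 1] \<open>n \<ge> 2\<close> by auto
    ultimately show False
      using no_globally_dominates_cycle[OF \<open>wf P\<close>] by blast
  qed
  with globally_optimal_iff_undominated[OF \<open>finite I\<close>] show ?thesis
    by (intro conjI allI impI)
qed

end
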